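(* Let $d$ be a positive integer and $K_d=C_{2^d}^2$. Then there exists a signature set on $K_d$ with respect to the unique subgroup of $K_d$ isomorphic to $C_2^2$.
   Context: For $A=\sum a_g g\in\mathbb{Z}K$, $A^{(-1)}=\sum a_g g^{-1}$. Let $E=\langle x_1,x_2\rangle\cong C_2^2$ be a subgroup of the abelian group $K$, $U_2=\mathrm{GF}(2)^2$, and for $u\in U_2$ let $\chi_u=(1+(-1)^{u_1}x_1)(1+(-1)^{u_2}x_2)\in\mathbb{Z}E$ (the characters of $E$). A signature block on $K$ with respect to $\chi_u$ is an element $A_u\in\mathbb{Z}K$ that is $\{\pm1\}$-valued on some set of coset representatives for $E$ in $K$ and zero elsewhere, satisfying $A_u\chi_uA_u^{(-1)}=\frac{|K|}{4}\chi_u$ in $\mathbb{Z}K$. A signature set on $K$ with respect to $E$ is a multiset $\{A_u:u\in U_2\}$ where each $A_u$ is a signature block with respect to $\chi_u$. *)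

theory Defs
  imports
    "HOL-Algebra.Free_Abelian_Groups"
    "HOL-Algebra.Elementary_Groups"
    "HOL-Library.Multiset"
    "HOL-Library.Z2"
begin

definition cyclic_square :: "nat \<Rightarrow> (int \<times> int) monoid" where
  "cyclic_square n = integer_mod_group n \<times>\<times> integer_mod_group n"

text \<open>
  The integral group ring of \<open>K\<close> consists of the elements of type \<open>'a \<Rightarrow>\<^sub>0 int\<close> supported on
  \<^term>\<open>carrier K\<close>, that is, of \<^term>\<open>carrier (free_Abelian_group (carrier K))\<close>. Its
  addition is that of the type; multiplication and inversion are the (bi)linear extensions of
  the group operations.
\<close>

definition gr_mult :: "('a, 'b) monoid_scheme \<Rightarrow> ('a \<Rightarrow>\<^sub>0 int) \<Rightarrow> ('a \<Rightarrow>\<^sub>0 int) \<Rightarrow> ('a \<Rightarrow>\<^sub>0 int)" where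
  "gr_mult K A B = frag_extend (\<lambda>g. frag_extend (\<lambda>h. frag_of (g \<otimes>\<^bsub>K\<^esub> h)) B) A"

definition gr_inverse :: "('a, 'b) monoid_scheme \<Rightarrow> ('a \<Rightarrow>\<^sub>0 int) \<Rightarrow> ('a \<Rightarrow>\<^sub>0 int)" where
  "gr_inverse K A = frag_extend (\<lambda>g. frag_of (inv\<^bsub>K\<^esub> g)) A"

definition gr_char :: "('a, 'b) monoid_scheme \<Rightarrow> 'a \<Rightarrow> 'a \<Rightarrow> bit \<times> bit \<Rightarrow> ('a \<Rightarrow>\<^sub>0 int)" where
  "gr_char K x\<^sub>1 x\<^sub>2 u =
     gr_mult K (frag_of \<one>\<^bsub>K\<^esub> + frag_cmul ((-1) ^ (of_bit (fst u) :: nat)) (frag_of x\<^sub>1))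
               (frag_of \<one>\<^bsub>K\<^esub> + frag_cmul ((-1) ^ (of_bit (snd u) :: nat)) (frag_of x\<^sub>2))"

definition coset_representatives :: "('a, 'b) monoid_scheme \<Rightarrow> 'a set \<Rightarrow> 'a set \<Rightarrow> bool" where
  "coset_representatives K E T \<longleftrightarrow> T \<subseteq> carrier K \<and> (\<forall>C \<in> rcosets\<^bsub>K\<^esub> E. \<exists>!t. t \<in> T \<and> t \<in> C)"

text \<open>
  The integer division below is exact, since \<open>E\<close> is a subgroup of \<open>K\<close> of order 4.
\<close>

definition signature_block ::
    "('a, 'b) monoid_scheme \<Rightarrow> 'a set \<Rightarrow> ('a \<Rightarrow>\<^sub>0 int) \<Rightarrow> ('a \<Rightarrow>\<^sub>0 int) \<Rightarrow> bool" where
  "signature_block K E \<chi> A \<longleftrightarrow>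
     A \<in> carrier (free_Abelian_group (carrier K)) \<and>
     (\<exists>T. coset_representatives K E T \<and>
        (\<forall>g \<in> T. Poly_Mapping.lookup A g \<in> {1, -1}) \<and>
        (\<forall>g. g \<notin> T \<longrightarrow> Poly_Mapping.lookup A g = 0)) \<and>
     gr_mult K (gr_mult K A \<chi>) (gr_inverse K A) = frag_cmul (int (order K div 4)) \<chi>"

text \<open>
  The multiset is indexed by \<open>{0, 1} \<times> {0, 1}\<close>, which is all of \<open>GF(2)\<^sup>2\<close>, the type \<^typ>\<open>bit\<close>
  being the field with two elements. The subgroup \<open>E\<close> is the one generated by \<open>x\<^sub>1\<close> and \<open>x\<^sub>2\<close>.
\<close>

definition signature_set ::
    "('a, 'b) monoid_scheme \<Rightarrow> 'a \<Rightarrow> 'a \<Rightarrow> ('a \<Rightarrow>\<^sub>0 int) multiset \<Rightarrow> bool" where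
  "signature_set K x\<^sub>1 x\<^sub>2 M \<longleftrightarrow>
     (\<exists>A :: bit \<times> bit \<Rightarrow> ('a \<Rightarrow>\<^sub>0 int).
        M = image_mset A (mset_set ({0, 1} \<times> {0, 1})) \<and>
        (\<forall>u. signature_block K (generate K {x\<^sub>1, x\<^sub>2}) (gr_char K x\<^sub>1 x\<^sub>2 u) (A u)))"

end

theory Submission
  imports Defs
begin

text \<open>
  Write \<open>h = 2\<^sup>d\<^sup>-\<^sup>1\<close>. A \<open>{\<plusminus>1}\<close>-valued function on the square \<open>[0, h)\<^sup>2\<close> is a signature block for the
  character of \<open>E = {0, h}\<^sup>2\<close> with values \<open>a\<close>, \<open>b\<close> at \<open>(h, 0)\<close>, \<open>(0, h)\<close> if its extension to \<open>\<int>\<^sup>2\<close> that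
  picks up the sign \<open>a\<close> (resp. \<open>b\<close>) under translation by \<open>h\<close> in the first (resp. second) coordinate
  has vanishing autocorrelation at every shift outside \<open>(h\<int>)\<^sup>2\<close>. Such arrays exist for all four sign
  patterns by induction on \<open>d\<close>: interleaving, along the second coordinate, arrays of types \<open>(1, b)\<close> and \<open>(-1, b)\<close> gives
  an array of type \<open>(1, b)\<close> of twice the size, and the two remaining types arise from \<open>(1, -1)\<close>
  through automorphisms of the grid. Finally, any two generators of \<open>E\<close> are distinct involutions, so the
  characters indexed by them are the same four characters in another order.
\<close>

section \<open>Quasi-perfect arrays\<close>

text \<open>
  Condition for \<open>F\<close> to describe an element of modulus \<open>h\<close> in the twisted group ring
  \<open>\<int>[X, Y] / (X\<^sup>h - a, Y\<^sup>h - b)\<close>. Autocorrelations at shifts divisible by \<open>h\<close> are determined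
  by the quasi-periodicity, so only the others are constrained.
\<close>

definition quasiperfect :: "int \<Rightarrow> int \<Rightarrow> int \<Rightarrow> (int \<Rightarrow> int \<Rightarrow> int) \<Rightarrow> bool" where
  "quasiperfect h a b F \<longleftrightarrow>
     (\<forall>x y. F x y \<in> {1, -1}) \<and>
     (\<forall>x y. F (x + h) y = a * F x y) \<and>
     (\<forall>x y. F x (y + h) = b * F x y) \<and>
     (\<forall>s t. \<not> (h dvd s \<and> h dvd t) \<longrightarrow>
        (\<Sum>x\<in>{0..<h}. \<Sum>y\<in>{0..<h}. F x y * F (x + s) (y + t)) = 0)"

section \<open>Sums over integer intervals and quasi-periodic functions\<close>

lemma sum_shift_periodic:
  fixes f :: "int \<Rightarrow> 'a::ab_group_add"
  assumes "0 \<le> h" and per: "\<And>x. f (x + h) = f x"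
  shows "(\<Sum>x\<in>{0..<h}. f (x + c)) = (\<Sum>x\<in>{0..<h}. f x)"
proof -
  \<comment> \<open>Shifting by one trades the term \<open>f c\<close> for \<open>f (h + c)\<close>,
    which is equal by periodicity.\<close>
  have step: "(\<Sum>x\<in>{0..<h}. f (x + (c + 1))) = (\<Sum>x\<in>{0..<h}. f (x + c))" for c
  proof (cases "h = 0")
    case False
    then have "h > 0" using assms by simp
    have "(\<Sum>x\<in>{0..<h}. f (x + (c + 1))) = (\<Sum>x\<in>{1..<h+1}. f (x + c))"
      by (rule sum.reindex_bij_witness[where i="\<lambda>x. x - 1" and j="\<lambda>x. x + 1"])
         (auto simp: algebra_simps)
    also have "{1..<h+1} = insert h {1..<h}" using \<open>h > 0\<close> by auto
    also have "(\<Sum>x\<in>insert h {1..<h}. f (x + c)) = f c + (\<Sum>x\<in>{1..<h}. f (x + c))"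
      using per[of c] by (simp add: add.commute)
    also have "\<dots> = (\<Sum>x\<in>insert 0 {1..<h}. f (x + c))" by simp
    also have "insert 0 {1..<h} = {0..<h}" using \<open>h > 0\<close> by auto
    finally show ?thesis .
  qed simp
  show ?thesis
  proof (induction c rule: int_induct[where k = 0])
    case (step2 i)
    then show ?case using step[of "i - 1"] by simp
  qed (simp_all add: step)
qed

lemma sum_double_even_odd:
  fixes f :: "int \<Rightarrow> 'a::comm_monoid_add"
  shows "(\<Sum>y\<in>{0..<2*h}. f y) = (\<Sum>y\<in>{0..<h}. f (2 * y) + f (2 * y + 1))"
proof -
  have "{0..<2*h} = (\<lambda>y. 2 * y) ` {0..<h} \<union> (\<lambda>y. 2 * y + 1) ` {0..<h}"
  proof (intro equalityI subsetI)
    fix x assume "x \<in> {0..<2*h}"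
    moreover have "x = 2 * (x div 2) \<or> x = 2 * (x div 2) + 1" by presburger
    ultimately show "x \<in> (\<lambda>y. 2 * y) ` {0..<h} \<union> (\<lambda>y. 2 * y + 1) ` {0..<h}"
      by (auto intro!: image_eqI[of _ _ "x div 2"])
  qed auto
  moreover have "(\<lambda>y. 2 * y) ` {0..<h} \<inter> (\<lambda>y. 2 * y + 1) ` {0..<h} = {}"
    by auto presburger
  ultimately show ?thesis
    by (simp add: sum.union_disjoint sum.reindex inj_on_def sum.distrib)
qed

text \<open>Pairs \<open>x\<close> with \<open>x + h\<close>, where the two interleaved arrays
  behave with opposite signs.\<close>

lemma sum_double_halves:
  fixes f :: "int \<Rightarrow> 'a::comm_monoid_add"
  assumes "0 \<le> h"
  shows "(\<Sum>x\<in>{0..<2*h}. f x) = (\<Sum>x\<in>{0..<h}. f x + f (x + h))"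
proof -
  have "(\<Sum>x\<in>{0..<2*h}. f x) = (\<Sum>x\<in>{0..<h}. f x) + (\<Sum>x\<in>{h..<2*h}. f x)"
    using assms by (simp add: sum.union_disjoint[symmetric] ivl_disj_un_two)
  also have "(\<Sum>x\<in>{h..<2*h}. f x) = (\<Sum>x\<in>{0..<h}. f (x + h))"
    by (rule sum.reindex_bij_witness[where i="\<lambda>x. x + h" and j="\<lambda>x. x - h"]) auto
  finally show ?thesis by (simp add: sum.distrib)
qed

text \<open>The factor is the \<open>i\<close>-th power of \<open>c\<close>, which depends only on
  the parity of \<open>i\<close> because \<open>c\<close> is its own inverse; this also covers
  negative \<open>i\<close>.\<close>

lemma shift_multiple:
  fixes f :: "int \<Rightarrow> int"
  assumes "\<And>x. f (x + h) = c * f x" "c * c = 1"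
  shows "f (x + h * i) = (if even i then 1 else c) * f x"
proof (induction i rule: int_induct[where k = 0])
  case (step1 i)
  then show ?case using assms(1)[of "x + h * i"] assms(2) by (auto simp: algebra_simps)
next
  case (step2 i)
  have "f (x + h * (i - 1)) = c * c * f (x + h * (i - 1))" using assms(2) by simp
  also have "\<dots> = c * f (x + h * i)"
    using assms(1)[of "x + h * (i - 1)"] by (simp add: algebra_simps)
  finally show ?case using step2 assms(2) by (auto simp: algebra_simps)
qed simp

section \<open>Constructing arrays of all four sign types\<close>

lemma quasiperfect_swap:
  assumes "quasiperfect h a b F"
  shows "quasiperfect h b a (\<lambda>x y. F y x)"
proof -
  have "(\<Sum>x\<in>{0..<h}. \<Sum>y\<in>{0..<h}. F y x * F (y + t) (x + s)) = 0" if "\<not> (h dvd s \<and> h dvd t)" for s t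
    using that assms by (subst sum.swap) (auto simp: quasiperfect_def)
  then show ?thesis using assms unfolding quasiperfect_def by blast
qed

text \<open>This is the substitution \<open>X \<mapsto> X / Y\<close> in the twisted group ring.\<close>

lemma quasiperfect_shear:
  assumes "quasiperfect h a b F" "0 \<le> h" "a * a = 1" "b * b = 1"
  shows "quasiperfect h (a * b) b (\<lambda>x y. F x (x + y))"
proof -
  have F: "F x y \<in> {1, -1}" "F (x + h) y = a * F x y" "F x (y + h) = b * F x y" for x y
    using assms(1) by (auto simp: quasiperfect_def)
  have "(\<Sum>x\<in>{0..<h}. \<Sum>y\<in>{0..<h}. F x (x + y) * F (x + s) (x + s + (y + t))) = 0"
    if "\<not> (h dvd s \<and> h dvd t)" for s t
  proof -
    have "(\<Sum>y\<in>{0..<h}. F x (x + y) * F (x + s) (x + s + (y + t)))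
        = (\<Sum>y\<in>{0..<h}. F x y * F (x + s) (y + (s + t)))" for x
    proof -
      have *: "F (x + s) (y + h + (s + t)) = b * F (x + s) (y + (s + t))" for y
        using F(3)[of "x + s" "y + (s + t)"] by (simp add: algebra_simps)
      \<comment> \<open>Both factors pick up \<open>b\<close>, so the product is truly periodic in
        \<open>y\<close> and the offset \<open>x\<close> can be absorbed by shifting the range of
        summation.\<close>
      have "F x (y + h) * F (x + s) (y + h + (s + t)) = F x y * F (x + s) (y + (s + t))" for y
        using assms(4) by (simp add: F(3) * )
      from sum_shift_periodic[where f = "\<lambda>y. F x y * F (x + s) (y + (s + t))", OF assms(2) this, of x]
      show ?thesis
        by (simp add: algebra_simps)
    qed
    \<comment> \<open>The map \<open>(s, t)\<close> to \<open>(s, s + t)\<close> preserves the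
      lattice of shifts divisible by \<open>h\<close>, hence also its complement.\<close>
    moreover have "\<not> (h dvd s \<and> h dvd (s + t))"
      using that by (auto simp: dvd_add_right_iff)
    ultimately show ?thesis
      using assms(1) unfolding quasiperfect_def by simp
  qed
  moreover have "F (x + h) (x + h + y) = a * b * F x (x + y)" for x y
    using F(2)[of x "x + y + h"] F(3)[of x "x + y"] by (simp add: algebra_simps)
  moreover have "F x (x + (y + h)) = b * F x (x + y)" for x y
    using F(3)[of x "x + y"] by (simp add: algebra_simps)
  ultimately show ?thesis
    using F(1) unfolding quasiperfect_def by blast
qed

text \<open>
  The new array is \<open>B(X, Y\<^sup>2) (1 + X\<^sup>h) + Y C(X, Y\<^sup>2) (1 - X\<^sup>h)\<close>, which becomes \<open>2 B(X, Y\<^sup>2)\<close> where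
  \<open>X\<^sup>h = 1\<close> and \<open>2 Y C(X, Y\<^sup>2)\<close> where \<open>X\<^sup>h = -1\<close>.
\<close>

lemma quasiperfect_double:
  assumes B: "quasiperfect h 1 b B" and C: "quasiperfect h (-1) b C" and "0 < h" and bb: "b * b = 1"
  shows "quasiperfect (2 * h) 1 b (\<lambda>x y. if even y then B x (y div 2) else C x (y div 2))"
    (is "quasiperfect _ _ _ ?F")
proof -
  have B1: "B x y \<in> {1, -1}" "B (x + h) y = B x y" "B x (y + h) = b * B x y" for x y
    using B by (auto simp: quasiperfect_def)
  have C1: "C x y \<in> {1, -1}" "C (x + h) y = - C x y" "C x (y + h) = b * C x y" for x y
    using C by (auto simp: quasiperfect_def)
  have Bs: "B (x + h + s) y = B (x + s) y" and Cs: "C (x + h + s) y = - C (x + s) y" for x y s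
    using B1(2)[of "x + s" y] C1(2)[of "x + s" y] by (simp_all add: algebra_simps)
  have per: "?F (x + 2 * h) y = 1 * ?F x y" for x y
    using B1(2)[of "x + h"] B1(2)[of x] C1(2)[of "x + h"] C1(2)[of x]
    by (simp add: algebra_simps)
  have per2: "?F x (y + 2 * h) = b * ?F x y" for x y
    using B1(3)[of x "y div 2"] C1(3)[of x "y div 2"] by (simp add: algebra_simps)
  have cor: "(\<Sum>x\<in>{0..<2*h}. \<Sum>y\<in>{0..<2*h}. ?F x y * ?F (x + s) (y + t)) = 0"
    if nd: "\<not> (2 * h dvd s \<and> 2 * h dvd t)" for s t
  proof (cases "even t")
    case True
    then obtain r where r: "t = 2 * r" by blast
    let ?R = "\<lambda>F. \<Sum>x\<in>{0..<h}. \<Sum>y\<in>{0..<h}. F x y * F (x + s) (y + r) :: int"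
    have d: "(2 * y + t) div 2 = y + r" "(2 * y + 1 + t) div 2 = y + r" for y
      unfolding r by presburger+
    \<comment> \<open>An even shift correlates \<open>B\<close> with \<open>B\<close> and
      \<open>C\<close> with \<open>C\<close>; passing from \<open>x\<close> to \<open>x + h\<close>
      changes no product, hence the factor 2.\<close>
    have "(\<Sum>x\<in>{0..<2*h}. \<Sum>y\<in>{0..<2*h}. ?F x y * ?F (x + s) (y + t))
       = 2 * (?R B + ?R C)"
      using \<open>even t\<close> \<open>0 < h\<close>
      by (subst sum_double_halves) (simp_all add: sum_double_even_odd d B1 C1 Bs Cs sum.distrib sum_distrib_left)
    also have "?R B + ?R C = 0"
    proof (cases "h dvd s \<and> h dvd r")
      case False
      then show ?thesis using B C by (simp add: quasiperfect_def)
    next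
      case True
      then obtain i j where ij: "s = h * i" "r = h * j" by (auto elim!: dvdE)
      \<comment> \<open>Here \<open>t\<close> is a multiple of \<open>2 * h\<close>, so
        \<open>s\<close> is not. An odd multiple of \<open>h\<close> in the first coordinate
        preserves \<open>B\<close> and negates \<open>C\<close>, so the two autocorrelations
        cancel.\<close>
      have "odd i" using nd True by (auto simp: r ij(1))
      have "B (x + s) (y + r) = (if even j then 1 else b) * B x y" for x y
        unfolding ij using \<open>odd i\<close> shift_multiple[of "\<lambda>x. B x (y + h * j)" h 1 x i]
          shift_multiple[of "B x" h b y j] bb by (simp add: B1)
      moreover have "C (x + s) (y + r) = - (if even j then 1 else b) * C x y" for x y
        unfolding ij using \<open>odd i\<close> shift_multiple[of "\<lambda>x. C x (y + h * j)" h "-1" x i]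
          shift_multiple[of "C x" h b y j] bb by (simp add: C1)
      moreover have "B x y * B x y = 1" "C x y * C x y = 1" for x y
        using B1(1)[of x y] C1(1)[of x y] by auto
      ultimately show ?thesis
        by (simp add: mult.left_commute[of _ "if even j then 1 else b"])
    qed
    finally show ?thesis by simp
  next
    case False
    then obtain r where r: "t = 2 * r + 1" using oddE by blast
    have d: "(2 * y + t) div 2 = y + r" "(2 * y + 1 + t) div 2 = y + r + 1" for y
      unfolding r by presburger+
    have "(\<Sum>x\<in>{0..<2*h}. \<Sum>y\<in>{0..<2*h}. ?F x y * ?F (x + s) (y + t))
       = (\<Sum>x\<in>{0..<h}. (\<Sum>y\<in>{0..<2*h}. ?F x y * ?F (x + s) (y + t))
                     + (\<Sum>y\<in>{0..<2*h}. ?F (x + h) y * ?F (x + h + s) (y + t)))"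
      using \<open>0 < h\<close> by (intro sum_double_halves) simp
    \<comment> \<open>An odd shift correlates \<open>B\<close> with \<open>C\<close> only; the
      products at \<open>x\<close> and \<open>x + h\<close> cancel since \<open>C\<close> changes
      sign and \<open>B\<close> does not.\<close>
    also have "\<dots> = 0" using \<open>odd t\<close>
      by (simp add: sum_double_even_odd d B1 C1 Bs Cs flip: sum.distrib)
    finally show ?thesis .
  qed
  show ?thesis unfolding quasiperfect_def
    using B1(1) C1(1) per per2 cor by auto
qed


lemma quasiperfect_exists_all_signs:
  assumes "a \<in> {1, -1}" "b \<in> {1, -1}"
  shows "\<exists>F. quasiperfect (2 ^ k) a b F"
  using assms
proof (induction k arbitrary: a b)
  case 0
  \<comment> \<open>For \<open>h = 1\<close> every shift is divisible by \<open>h\<close>, so only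
    the signs under translation matter.\<close>
  have "quasiperfect 1 a b (\<lambda>x y. (if even x then 1 else a) * (if even y then 1 else b))"
    using 0 by (auto simp: quasiperfect_def)
  then show ?case by auto
next
  case (Suc k)
  have 1: "\<exists>F. quasiperfect (2 ^ Suc k) 1 b F" if "b \<in> {1, -1}" for b
  proof -
    have "\<exists>B. quasiperfect (2 ^ k) 1 b B" "\<exists>C. quasiperfect (2 ^ k) (-1) b C"
      using Suc.IH that by simp_all
    then obtain B C where "quasiperfect (2 ^ k) 1 b B" "quasiperfect (2 ^ k) (-1) b C"
      by blast
    then show ?thesis
      using quasiperfect_double[of "2 ^ k" b B C] that by auto
  qed
  \<comment> \<open>Swapping turns type \<open>(1, -1)\<close> into \<open>(-1, 1)\<close>, and
    shearing turns it into \<open>(-1, -1)\<close>.\<close>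
  then obtain F where F: "quasiperfect (2 ^ Suc k) 1 (-1) F" by blast
  show ?case
    using 1[OF Suc.prems(2)] quasiperfect_swap[OF F] quasiperfect_shear[OF F] Suc.prems by auto
qed

section \<open>Group rings and signature blocks\<close>

lemma gr_mult_add_right: "gr_mult K P (A + B) = gr_mult K P A + gr_mult K P B"
  unfolding gr_mult_def frag_extend_add
  by (simp add: frag_extend_def frag_cmul_distrib2 sum.distrib)

lemma gr_mult_cmul_right: "gr_mult K P (frag_cmul c A) = frag_cmul c (gr_mult K P A)"
  unfolding gr_mult_def frag_extend_cmul
  by (simp add: frag_extend_def frag_cmul_sum mult.left_commute)

lemma gr_mult_zero_right: "gr_mult K P 0 = 0"
  by (simp add: gr_mult_def frag_extend_eq_0)

lemma gr_mult_sum_right: "gr_mult K P (sum f I) = (\<Sum>i\<in>I. gr_mult K P (f i))"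
  by (induction I rule: infinite_finite_induct) (simp_all add: gr_mult_zero_right gr_mult_add_right)

lemma keys_gr_mult:
  assumes "group K" "Poly_Mapping.keys A \<subseteq> carrier K" "Poly_Mapping.keys B \<subseteq> carrier K"
  shows "Poly_Mapping.keys (gr_mult K A B) \<subseteq> carrier K"
proof -
  interpret group K by fact
  show ?thesis
    unfolding gr_mult_def using assms(2,3)
    by (auto intro!: order_trans[OF keys_frag_extend] UN_least) blast
qed

lemma keys_gr_inverse:
  assumes "group K" "Poly_Mapping.keys A \<subseteq> carrier K"
  shows "Poly_Mapping.keys (gr_inverse K A) \<subseteq> carrier K"
proof -
  interpret group K by fact
  show ?thesis
    unfolding gr_inverse_def using assms(2)
    by (auto intro!: order_trans[OF keys_frag_extend])
qed

lemma lookup_gr_mult_frag_of: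
  assumes "group K" "Poly_Mapping.keys P \<subseteq> carrier K" "c \<in> carrier K" "g \<in> carrier K"
  shows "Poly_Mapping.lookup (gr_mult K P (frag_of c)) g = Poly_Mapping.lookup P (g \<otimes>\<^bsub>K\<^esub> inv\<^bsub>K\<^esub> c)"
proof -
  interpret group K by fact
  have "Poly_Mapping.lookup (gr_mult K P (frag_of c)) g
      = (\<Sum>i\<in>Poly_Mapping.keys P. Poly_Mapping.lookup P i * (if g = i \<otimes>\<^bsub>K\<^esub> c then 1 else 0))"
    by (simp add: gr_mult_def frag_extend_def lookup_sum)
  also have "\<dots> = (\<Sum>i\<in>Poly_Mapping.keys P. if i = g \<otimes>\<^bsub>K\<^esub> inv\<^bsub>K\<^esub> c then Poly_Mapping.lookup P i else 0)"
    using assms by (intro sum.cong) (auto simp: m_assoc inv_solve_right subset_iff)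
  finally show ?thesis by (simp add: in_keys_iff)
qed

text \<open>A product \<open>p\<close> times the inverse of \<open>k\<close> equals \<open>g\<close>
  exactly when \<open>p\<close> is \<open>g\<close> times \<open>k\<close>. This turns the block
  equation into a statement about correlations.\<close>

lemma lookup_gr_mult_gr_inverse:
  assumes "group K" "Poly_Mapping.keys P \<subseteq> carrier K" "Poly_Mapping.keys A \<subseteq> carrier K" "g \<in> carrier K"
  shows "Poly_Mapping.lookup (gr_mult K P (gr_inverse K A)) g
       = (\<Sum>k\<in>Poly_Mapping.keys A. Poly_Mapping.lookup A k * Poly_Mapping.lookup P (g \<otimes>\<^bsub>K\<^esub> k))"
proof -
  interpret group K by fact
  show ?thesis
    using assms unfolding gr_inverse_def frag_extend_def[of _ A]
    by (auto simp: gr_mult_sum_right gr_mult_cmul_right lookup_sum lookup_gr_mult_frag_of subset_iff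
             intro!: sum.cong)
qed

section \<open>The group \<open>cyclic_square (2 * h)\<close> and its subgroup of
  involutions\<close>

lemma comm_group_cyclic_square: "comm_group (cyclic_square n)"
  unfolding cyclic_square_def
  by (auto intro!: group.group_comm_groupI DirProd_group simp: add.commute)

lemma cyclic_square_simps:
  assumes "n > 0"
  shows "carrier (cyclic_square n) = {0..<int n} \<times> {0..<int n}"
    and "\<one>\<^bsub>cyclic_square n\<^esub> = (0, 0)"
    and "(x, y) \<otimes>\<^bsub>cyclic_square n\<^esub> (x', y') = ((x + x') mod int n, (y + y') mod int n)"
    and "x \<in> {0..<int n} \<Longrightarrow> y \<in> {0..<int n} \<Longrightarrow>
      inv\<^bsub>cyclic_square n\<^esub> (x, y) = ((- x) mod int n, (- y) mod int n)"
  using assms by (simp_all add: cyclic_square_def carrier_integer_mod_group)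

lemma lookup_frag_expansion:
  assumes "finite T"
  shows "Poly_Mapping.lookup (\<Sum>g\<in>T. frag_cmul (f g) (frag_of g)) x = (if x \<in> T then f x else 0)"
proof -
  have "Poly_Mapping.lookup (\<Sum>g\<in>T. frag_cmul (f g) (frag_of g)) x = (\<Sum>g\<in>T. if g = x then f g else 0)"
    by (auto simp: lookup_sum intro!: sum.cong)
  then show ?thesis using assms by simp
qed

lemma involutions_subgroup:
  assumes h: "h > 0"
  shows "subgroup ({0, int h} \<times> {0, int h}) (cyclic_square (2 * h))"
proof -
  interpret comm_group "cyclic_square (2 * h)" by (rule comm_group_cyclic_square)
  show ?thesis
    using h by (intro subgroupI) (auto simp: cyclic_square_simps zmod_zminus1_eq_if)
qed

text \<open>Reducing both coordinates mod \<open>h\<close> is constant on cosets and yields the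
  representative in the square.\<close>

lemma coset_representatives_square:
  assumes h: "h > 0"
  shows "coset_representatives (cyclic_square (2 * h)) ({0, int h} \<times> {0, int h}) ({0..<int h} \<times> {0..<int h})"
  unfolding coset_representatives_def
proof (intro conjI ballI)
  show "{0..<int h} \<times> {0..<int h} \<subseteq> carrier (cyclic_square (2 * h))"
    using h by (auto simp: cyclic_square_simps)
  have red: "(e + x) mod int (2 * h) mod int h = x mod int h"
    if "e \<in> {0, int h}" for e x
    using that by (auto simp: mod_mod_cancel)
  fix C assume "C \<in> rcosets\<^bsub>cyclic_square (2 * h)\<^esub> ({0, int h} \<times> {0, int h})"
  then obtain x y where xy: "x \<in> {0..<2 * int h}" "y \<in> {0..<2 * int h}"
    and "C = ({0, int h} \<times> {0, int h}) #>\<^bsub>cyclic_square (2 * h)\<^esub> (x, y)"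
    using h by (auto simp: RCOSETS_def cyclic_square_simps)
  then have C: "C = (\<lambda>e. (e + x) mod int (2 * h)) ` {0, int h} \<times> (\<lambda>f. (f + y) mod int (2 * h)) ` {0, int h}"
    using h by (auto simp: r_coset_def cyclic_square_simps)
  \<comment> \<open>One of the summands 0 and \<open>h\<close> moves \<open>z\<close> into the lower
    half mod \<open>2 * h\<close>.\<close>
  have mem: "z mod int h \<in> (\<lambda>e. (e + z) mod int (2 * h)) ` {0, int h}" if "z \<in> {0..<2 * int h}" for z
  proof (cases "z < int h")
    case False
    then have "z mod int h = z - int h" "(int h + z) mod int (2 * h) = z - int h"
      using that by (auto intro!: int_mod_pos_eq[where q = 1])
    then show ?thesis by simp
  qed (use that in simp)
  show "\<exists>!t. t \<in> {0..<int h} \<times> {0..<int h} \<and> t \<in> C"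
  proof (rule ex1I[of _ "(x mod int h, y mod int h)"])
    show "(x mod int h, y mod int h) \<in> {0..<int h} \<times> {0..<int h} \<and> (x mod int h, y mod int h) \<in> C"
      using h mem[OF xy(1)] mem[OF xy(2)] unfolding C by (auto simp del: image_insert)
  next
    fix t assume t: "t \<in> {0..<int h} \<times> {0..<int h} \<and> t \<in> C"
    then obtain e f where "e \<in> {0, int h}" "f \<in> {0, int h}"
      "t = ((e + x) mod int (2 * h), (f + y) mod int (2 * h))"
      unfolding C by blast
    moreover from t have "fst t mod int h = fst t" "snd t mod int h = snd t" by auto
    ultimately show "t = (x mod int h, y mod int h)"
      by (metis red fst_conv snd_conv)
  qed
qed

text \<open>The block is \<open>F\<close> restricted to the square. The coefficient of the triple
  product at \<open>(s, t)\<close> is the autocorrelation of \<open>F\<close> at that shift: zero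
  off the subgroup, and \<open>h * h\<close> times the character sign on it.\<close>

lemma signature_block_quasiperfect:
  assumes h: "h > 0" and F: "quasiperfect (int h) a b F" and ab: "a \<in> {1, -1}" "b \<in> {1, -1}"
  shows "\<exists>A. signature_block (cyclic_square (2 * h)) ({0, int h} \<times> {0, int h})
     (frag_of (0, 0) + frag_cmul a (frag_of (int h, 0)) + frag_cmul b (frag_of (0, int h))
      + frag_cmul (a * b) (frag_of (int h, int h))) A"
    (is "\<exists>A. signature_block ?K ?E ?\<chi> A")
proof -
  interpret comm_group ?K by (rule comm_group_cyclic_square)
  have h2: "2 * h > 0" using h by simp
  note K = cyclic_square_simps[OF h2]
  let ?T = "{0..<int h} \<times> {0..<int h}"
  define A where "A = (\<Sum>g\<in>?T. frag_cmul (F (fst g) (snd g)) (frag_of g))"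
  have F1: "F x y \<in> {1, -1}" "F (x + int h) y = a * F x y" "F x (y + int h) = b * F x y" for x y
    using F by (auto simp: quasiperfect_def)
  have F0: "F x y \<noteq> 0" for x y using F1(1)[of x y] by auto
  have sq: "a * a = 1" "b * b = 1" using ab by auto
  have lookA: "Poly_Mapping.lookup A (x, y) = (if (x, y) \<in> ?T then F x y else 0)" for x y
    unfolding A_def by (subst lookup_frag_expansion) auto
  have keysA: "Poly_Mapping.keys A = ?T"
    using F0 by (auto simp: in_keys_iff lookA split: if_splits)
  have keysA': "Poly_Mapping.keys A \<subseteq> carrier ?K" using h by (auto simp: keysA K)
  have key\<chi>: "Poly_Mapping.keys ?\<chi> \<subseteq> carrier ?K"
    using h by (intro order_trans[OF keys_add] Un_least) (auto simp: K)
  define P where "P = gr_mult ?K A ?\<chi>"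
  have keysP: "Poly_Mapping.keys P \<subseteq> carrier ?K"
    unfolding P_def by (rule keys_gr_mult[OF is_group keysA' key\<chi>])
  \<comment> \<open>Multiplying by \<open>\<chi>\<close> extends the block quasi-periodically from \<open>?T\<close> to the whole group.\<close>
  have lookP: "Poly_Mapping.lookup P (x, y) = F x y" if "x \<in> {0..<2 * int h}" "y \<in> {0..<2 * int h}" for x y
  proof -
    have m: "(z - int h) mod (2 * int h) = (if z < int h then z + int h else z - int h)"
      if "z \<in> {0..<2 * int h}" for z
      using that by (auto intro: int_mod_pos_eq[where q = "-1"] int_mod_pos_eq[where q = 0])
    have k: "(z + - int h mod (2 * int h)) mod (2 * int h) = (z - int h) mod (2 * int h)" for z
      by (metis diff_conv_add_uminus mod_add_right_eq)
    have "Poly_Mapping.lookup P (x, y) = Poly_Mapping.lookup A (x, y) + a * Poly_Mapping.lookup A ((x - int h) mod (2 * int h), y)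
      + b * Poly_Mapping.lookup A (x, (y - int h) mod (2 * int h))
      + a * b * Poly_Mapping.lookup A ((x - int h) mod (2 * int h), (y - int h) mod (2 * int h))"
      unfolding P_def using that h keysA'
      by (simp add: gr_mult_add_right gr_mult_cmul_right lookup_add lookup_gr_mult_frag_of K k)
    also have "\<dots> = F x y"
      \<comment> \<open>Exactly one of the four translates lies in the square, and its sign is the
        one that quasi-periodicity gives to \<open>F x y\<close>.\<close>
      using that F1(2)[of "x - int h" y] F1(2)[of "x - int h" "y - int h"]
        F1(3)[of x "y - int h"]
      by (auto simp: m lookA mult.assoc)
    finally show ?thesis .
  qed
  \<comment> \<open>Translation by \<open>2 * h\<close> multiplies by a square of a sign, so
    \<open>F\<close> is well defined on the group.\<close>
  have Fmod: "F (x mod (2 * int h)) (y mod (2 * int h)) = F x y" for x y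
  proof -
    have "F (x mod (2 * int h)) v = F x v" for v
      using shift_multiple[of "\<lambda>x. F x v" "int h" a "x mod (2 * int h)" "2 * (x div (2 * int h))"]
      by (simp add: F1 sq mult.assoc[symmetric] mult.commute)
    moreover have "F u (y mod (2 * int h)) = F u y" for u
      using shift_multiple[of "F u" "int h" b "y mod (2 * int h)" "2 * (y div (2 * int h))"]
      by (simp add: F1 sq mult.assoc[symmetric] mult.commute)
    ultimately show ?thesis by simp
  qed
  have "gr_mult ?K P (gr_inverse ?K A) = frag_cmul (int (order ?K div 4)) ?\<chi>"
  proof (rule poly_mapping_eqI)
    fix g
    have ord: "int (order ?K div 4) = int h * int h"
    proof -
      have "nat (2 * int h) * nat (2 * int h) = 4 * (h * h)" by (simp add: nat_mult_distrib)
      then show ?thesis by (simp add: order_def K)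
    qed
    show "Poly_Mapping.lookup (gr_mult ?K P (gr_inverse ?K A)) g = Poly_Mapping.lookup (frag_cmul (int (order ?K div 4)) ?\<chi>) g"
    proof (cases "g \<in> carrier ?K")
      case False
      then have "g \<notin> Poly_Mapping.keys (gr_mult ?K P (gr_inverse ?K A))" "g \<notin> Poly_Mapping.keys ?\<chi>"
        using key\<chi> keys_gr_mult[OF is_group keysP keys_gr_inverse[OF is_group keysA']] by auto
      then show ?thesis by (simp add: in_keys_iff del: lookup_add)
    next
      case True
      then obtain s t where g: "g = (s, t)" and st: "s \<in> {0..<2 * int h}" "t \<in> {0..<2 * int h}"
        by (auto simp: K)
      have "Poly_Mapping.lookup (gr_mult ?K P (gr_inverse ?K A)) g
        = (\<Sum>(x, y)\<in>?T. F x y * Poly_Mapping.lookup P (g \<otimes>\<^bsub>?K\<^esub> (x, y)))"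
        using True by (subst lookup_gr_mult_gr_inverse[OF is_group keysP keysA'])
          (auto simp: keysA lookA intro!: sum.cong)
      also have "\<dots> = (\<Sum>(x, y)\<in>?T. F x y * F (x + s) (y + t))"
        using h by (intro sum.cong) (auto simp: g K lookP Fmod add.commute)
      also have "\<dots> = (\<Sum>x\<in>{0..<int h}. \<Sum>y\<in>{0..<int h}. F x y * F (x + s) (y + t))"
        by (simp add: sum.cartesian_product)
      also have "\<dots> = int h * int h * Poly_Mapping.lookup ?\<chi> g"
      proof (cases "int h dvd s \<and> int h dvd t")
        case True
        have "z \<in> {0, int h}" if "int h dvd z" "z \<in> {0..<2 * int h}" for z
          using that by (auto elim!: dvdE simp: zero_le_mult_iff mult.commute[of _ "int h"]) 
        with True st have "s \<in> {0, int h}" "t \<in> {0, int h}" by blast+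
        \<comment> \<open>On the subgroup, translating \<open>F\<close> multiplies it by the
          character coefficient \<open>e\<close>; as \<open>F\<close> squares to 1, each of the
          \<open>h * h\<close> points contributes \<open>e\<close>.\<close>
        then have "\<exists>e. (\<forall>x y. F (x + s) (y + t) = e * F x y) \<and> Poly_Mapping.lookup ?\<chi> g = e"
          using h by (auto simp: g F1 lookup_add)
        then obtain e where e: "F (x + s) (y + t) = e * F x y" "Poly_Mapping.lookup ?\<chi> g = e" for x y
          by blast
        have "F x y * (e * F x y) = e" for x y using F1(1)[of x y] by auto
        then show ?thesis by (simp only: e) simp
      next
        case False
        then have "Poly_Mapping.lookup ?\<chi> g = 0" by (auto simp: g lookup_add)
        then show ?thesis using F False by (simp add: quasiperfect_def)
      qed
      finally show ?thesis by (simp add: ord)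
    qed
  qed
  moreover have "\<forall>g\<in>?T. Poly_Mapping.lookup A g \<in> {1, -1}"
  proof
    fix g assume "g \<in> ?T"
    then show "Poly_Mapping.lookup A g \<in> {1, -1}"
      using F1(1)[of "fst g" "snd g"] lookA[of "fst g" "snd g"] by simp
  qed
  moreover have "\<forall>g. g \<notin> ?T \<longrightarrow> Poly_Mapping.lookup A g = 0"
    using lookA by auto
  ultimately have "signature_block ?K ?E ?\<chi> A"
    unfolding signature_block_def P_def
    using keysA' coset_representatives_square[OF h] by (metis carrier_free_Abelian_group_iff)
  then show ?thesis by blast
qed

section \<open>Existence and uniqueness of the subgroup isomorphic to
  \<open>cyclic_square 2\<close>\<close>

lemma iso_cyclic_square_2:
  assumes "h > 0"
  shows "(cyclic_square (2 * h))\<lparr>carrier := {0, int h} \<times> {0, int h}\<rparr> \<cong> cyclic_square 2"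
proof -
  let ?K = "(cyclic_square (2 * h))\<lparr>carrier := {0, int h} \<times> {0, int h}\<rparr>"
  let ?f = "\<lambda>(x, y). (x div int h, y div int h)"
  have "{0..<2::int} = {0, 1}" by auto
  then have "?f \<in> iso ?K (cyclic_square 2)"
    using assms by (auto simp: iso_def hom_def bij_betw_def inj_on_def cyclic_square_simps)
  then show ?thesis unfolding is_iso_def by blast
qed

text \<open>Exponent 2 transfers through the isomorphism, so \<open>E\<close> lies in the 2-torsion;
  that has four elements, as does \<open>E\<close>.\<close>

lemma subgroup_iso_cyclic_square_2_unique:
  assumes "h > 0" and E: "subgroup E (cyclic_square (2 * h))"
    and iso: "(cyclic_square (2 * h))\<lparr>carrier := E\<rparr> \<cong> cyclic_square 2"
  shows "E = {0, int h} \<times> {0, int h}"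
proof -
  let ?K = "cyclic_square (2 * h)"
  interpret K: comm_group ?K by (rule comm_group_cyclic_square)
  have h2: "2 * h > 0" using assms(1) by simp
  note K = cyclic_square_simps[OF h2]
  obtain f where f: "f \<in> iso (?K\<lparr>carrier := E\<rparr>) (cyclic_square 2)"
    using iso unfolding is_iso_def by blast
  then have bij: "bij_betw f E (carrier (cyclic_square 2))" by (simp add: iso_def)
  have hom: "f (x \<otimes>\<^bsub>?K\<^esub> y) = f x \<otimes>\<^bsub>cyclic_square 2\<^esub> f y" if "x \<in> E" "y \<in> E" for x y
    using f that by (simp add: iso_def hom_def)
  have four: "card E = 4"
    using bij_betw_same_card[OF bij] by (simp add: cyclic_square_simps)
  have "g \<in> {0, int h} \<times> {0, int h}" if g: "g \<in> E" for g
  proof -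
    have "f g \<otimes>\<^bsub>cyclic_square 2\<^esub> f g = (0, 0)" for g
      by (cases "f g") (simp add: cyclic_square_simps)
    \<comment> \<open>The unit is written as a square so that both images are squares in
      \<open>cyclic_square 2\<close>, hence \<open>(0, 0)\<close>.\<close>
    then have "f (g \<otimes>\<^bsub>?K\<^esub> g) = f (\<one>\<^bsub>?K\<^esub> \<otimes>\<^bsub>?K\<^esub> \<one>\<^bsub>?K\<^esub>)"
      using hom[OF g g] hom[OF subgroup.one_closed[OF E] subgroup.one_closed[OF E]] by simp
    then have "g \<otimes>\<^bsub>?K\<^esub> g = (0, 0)"
      using bij g subgroup.one_closed[OF E] subgroup.m_closed[OF E g g]
      by (auto simp: bij_betw_def inj_on_def K)
    moreover obtain x y where xy: "g = (x, y)" "x \<in> {0..<2 * int h}" "y \<in> {0..<2 * int h}"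
      using subgroup.mem_carrier[OF E g] by (auto simp: K)
    moreover have "z \<in> {0, int h}" if "(z + z) mod int (2 * h) = 0" "z \<in> {0..<2 * int h}" for z
    proof -
      have "int h dvd z" using that(1) by (auto simp: mod_eq_0_iff_dvd simp flip: mult_2)
      then show ?thesis using that(2) by (auto elim!: dvdE simp: zero_le_mult_iff mult.commute[of _ "int h"])
    qed
    ultimately have "x \<in> {0, int h}" "y \<in> {0, int h}" by (simp_all only: K prod.inject)
    then show ?thesis unfolding xy by blast
  qed
  then have "E \<subseteq> {0, int h} \<times> {0, int h}" by blast
  moreover have "card ({0, int h} \<times> {0, int h}) = 4"
    using assms(1) by (simp add: card_cartesian_product)
  ultimately show ?thesis
    using four by (intro card_subset_eq) auto
qed

section \<open>Arbitrary generators of the subgroup\<close>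

text \<open>Commuting involutions make the four listed elements closed under products. The resulting
  bound on the order forces generators of a group of order 4 to be distinct and nontrivial.\<close>

lemma generate_involutions_subset:
  fixes G (structure)
  assumes "comm_group G" "x \<in> carrier G" "y \<in> carrier G"
    and "x \<otimes> x = \<one>" "y \<otimes> y = \<one>"
  shows "generate G {x, y} \<subseteq> {\<one>, x, y, x \<otimes> y}"
proof -
  interpret comm_group G by fact
  have inv: "inv x = x" "inv y = y" using assms by (simp_all add: inv_equality)
  have xx: "x \<otimes> (x \<otimes> z) = z" "y \<otimes> (y \<otimes> z) = z" if "z \<in> carrier G" for z
    using that assms by (simp_all flip: m_assoc)
  show ?thesis
  proof
    fix z assume "z \<in> generate G {x, y}"
    then show "z \<in> {\<one>, x, y, x \<otimes> y}"
    proof (induction rule: generate.induct)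
      case (eng g g')
      then show ?case using assms(2-5) by (auto simp: m_ac xx)
    qed (auto simp: inv)
  qed
qed

lemma gr_char_eq:
  assumes "group K" "x \<in> carrier K" "y \<in> carrier K"
  shows "gr_char K x y u = frag_of \<one>\<^bsub>K\<^esub> + frag_cmul ((-1) ^ of_bit (fst u)) (frag_of x)
    + frag_cmul ((-1) ^ of_bit (snd u)) (frag_of y)
    + frag_cmul ((-1) ^ of_bit (fst u) * (-1) ^ of_bit (snd u)) (frag_of (x \<otimes>\<^bsub>K\<^esub> y))"
proof -
  interpret group K by fact
  show ?thesis using assms
    by (simp add: gr_char_def gr_mult_def frag_extend_add frag_extend_cmul frag_cmul_distrib2 add_ac)
qed

lemma signature_block_exists:
  assumes gen: "{0, 2 ^ k} \<times> {0, 2 ^ k} = generate (cyclic_square (2 * 2 ^ k)) {x\<^sub>1, x\<^sub>2}"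
    and x: "x\<^sub>1 \<in> {0, 2 ^ k} \<times> {0, 2 ^ k}" "x\<^sub>2 \<in> {0, 2 ^ k} \<times> {0, 2 ^ k}"
  shows "\<exists>A. signature_block (cyclic_square (2 * 2 ^ k)) ({0, 2 ^ k} \<times> {0, 2 ^ k})
    (gr_char (cyclic_square (2 * 2 ^ k)) x\<^sub>1 x\<^sub>2 u) A"
proof -
  let ?K = "cyclic_square (2 * 2 ^ k)"
  define h :: nat where "h = 2 ^ k"
  have h: "h > 0" "int h = 2 ^ k" by (simp_all add: h_def)
  have h2: "2 * h > 0" using h by simp
  note K = cyclic_square_simps[OF h2, unfolded h_def, simplified]
  let ?\<chi> = "\<lambda>a b. frag_of (0, 0) + frag_cmul a (frag_of (int h, 0)) + frag_cmul b (frag_of (0, int h))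
      + frag_cmul (a * b) (frag_of (int h, int h))"
  have block: "\<exists>A. signature_block ?K ({0, 2 ^ k} \<times> {0, 2 ^ k}) (?\<chi> a b) A"
    if ab: "a \<in> {1, -1}" "b \<in> {1, -1}" for a b
  proof -
    obtain F where "quasiperfect (int h) a b F"
      using quasiperfect_exists_all_signs[OF ab] h by auto
    then show ?thesis
      using signature_block_quasiperfect[OF h(1) _ ab] by (simp add: h_def)
  qed
  have carr: "x\<^sub>1 \<in> carrier ?K" "x\<^sub>2 \<in> carrier ?K" using x by (auto simp: K)
  have "generate ?K {x\<^sub>1, x\<^sub>2} \<subseteq> {\<one>\<^bsub>?K\<^esub>, x\<^sub>1, x\<^sub>2, x\<^sub>1 \<otimes>\<^bsub>?K\<^esub> x\<^sub>2}"
    using x carr by (intro generate_involutions_subset comm_group_cyclic_square) (auto simp: K)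
  then have "card ({0, 2 ^ k} \<times> {0, 2 ^ k} :: (int \<times> int) set) \<le> card {\<one>\<^bsub>?K\<^esub>, x\<^sub>1, x\<^sub>2, x\<^sub>1 \<otimes>\<^bsub>?K\<^esub> x\<^sub>2}"
    unfolding gen by (intro card_mono) auto
  then have "card {\<one>\<^bsub>?K\<^esub>, x\<^sub>1, x\<^sub>2, x\<^sub>1 \<otimes>\<^bsub>?K\<^esub> x\<^sub>2} \<ge> 4"
    by (simp add: card_cartesian_product)
  then have dist: "x\<^sub>1 \<noteq> (0, 0)" "x\<^sub>2 \<noteq> (0, 0)" "x\<^sub>1 \<noteq> x\<^sub>2"
    by (auto simp: K card_insert_if split: if_splits)
  define a b :: int where "a = (-1) ^ of_bit (fst u)" and "b = (-1) ^ of_bit (snd u)"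
  have ab: "a \<in> {1, -1}" "b \<in> {1, -1}" and sq: "a * a = 1" "b * b = 1"
    unfolding a_def b_def by (auto simp: minus_one_power_iff)
  have sq': "a * (a * c) = c" "b * (b * c) = c" for c using sq by (simp_all flip: mult.assoc)
  have prod: "a * b \<in> {1, -1}" using ab by auto
  have \<chi>: "gr_char ?K x\<^sub>1 x\<^sub>2 u = frag_of (0, 0) + frag_cmul a (frag_of x\<^sub>1) + frag_cmul b (frag_of x\<^sub>2)
      + frag_cmul (a * b) (frag_of (x\<^sub>1 \<otimes>\<^bsub>?K\<^esub> x\<^sub>2))"
    using gr_char_eq[OF comm_group.axioms(2)[OF comm_group_cyclic_square] carr, of u]
    by (simp add: K a_def b_def)
  \<comment> \<open>A character is determined by its values at \<open>(int h, 0)\<close> and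
    \<open>(0, int h)\<close>. Each of these points is \<open>x\<^sub>1\<close>,
    \<open>x\<^sub>2\<close> or their product, with value \<open>a\<close>, \<open>b\<close> or
    \<open>a * b\<close>.\<close>
  have "\<exists>a' b'. a' \<in> {1, -1} \<and> b' \<in> {1, -1} \<and> gr_char ?K x\<^sub>1 x\<^sub>2 u = ?\<chi> a' b'"
  proof -
    \<comment> \<open>These are the six ordered pairs of distinct nontrivial elements of the
      subgroup.\<close>
    consider "x\<^sub>1 = (int h, 0)" "x\<^sub>2 = (0, int h)" | "x\<^sub>1 = (0, int h)" "x\<^sub>2 = (int h, 0)"
      | "x\<^sub>1 = (int h, 0)" "x\<^sub>2 = (int h, int h)" | "x\<^sub>1 = (int h, int h)" "x\<^sub>2 = (int h, 0)"
      | "x\<^sub>1 = (0, int h)" "x\<^sub>2 = (int h, int h)" | "x\<^sub>1 = (int h, int h)" "x\<^sub>2 = (0, int h)"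
      using dist x by (auto simp: h)
    then show ?thesis
    proof cases
      case 1
      then have "gr_char ?K x\<^sub>1 x\<^sub>2 u = ?\<chi> (a) (b)"
        unfolding \<chi> by (simp add: K h ac_simps sq sq')
      then show ?thesis using ab prod by blast
    next
      case 2
      then have "gr_char ?K x\<^sub>1 x\<^sub>2 u = ?\<chi> (b) (a)"
        unfolding \<chi> by (simp add: K h ac_simps sq sq')
      then show ?thesis using ab prod by blast
    next
      case 3
      then have "gr_char ?K x\<^sub>1 x\<^sub>2 u = ?\<chi> (a) (a * b)"
        unfolding \<chi> by (simp add: K h ac_simps sq sq')
      then show ?thesis using ab prod by blast
    next
      case 4
      then have "gr_char ?K x\<^sub>1 x\<^sub>2 u = ?\<chi> (b) (a * b)"
        unfolding \<chi> by (simp add: K h ac_simps sq sq')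
      then show ?thesis using ab prod by blast
    next
      case 5
      then have "gr_char ?K x\<^sub>1 x\<^sub>2 u = ?\<chi> (a * b) (a)"
        unfolding \<chi> by (simp add: K h ac_simps sq sq')
      then show ?thesis using ab prod by blast
    next
      case 6
      then have "gr_char ?K x\<^sub>1 x\<^sub>2 u = ?\<chi> (a * b) (b)"
        unfolding \<chi> by (simp add: K h ac_simps sq sq')
      then show ?thesis using ab prod by blast
    qed
  qed
  then show ?thesis using block by metis
qed

section \<open>Assembling the signature set\<close>

theorem theorem3p2:
  fixes d :: nat
  assumes "d > 0"
  shows "(\<exists>!E. subgroup E (cyclic_square (2 ^ d)) \<and>
               (cyclic_square (2 ^ d))\<lparr>carrier := E\<rparr> \<cong> cyclic_square 2) \<and>
         (\<forall>E x\<^sub>1 x\<^sub>2.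
            subgroup E (cyclic_square (2 ^ d)) \<and>
            (cyclic_square (2 ^ d))\<lparr>carrier := E\<rparr> \<cong> cyclic_square 2 \<and>
            x\<^sub>1 \<in> E \<and> x\<^sub>2 \<in> E \<and> E = generate (cyclic_square (2 ^ d)) {x\<^sub>1, x\<^sub>2} \<longrightarrow>
            (\<exists>M. signature_set (cyclic_square (2 ^ d)) x\<^sub>1 x\<^sub>2 M))"
proof -
  obtain k where d: "d = Suc k" using assms gr0_implies_Suc by blast
  let ?K = "cyclic_square (2 ^ d)" and ?E = "{0, 2 ^ k} \<times> {0, 2 ^ k} :: (int \<times> int) set"
  have h: "(2 ^ k :: nat) > 0" by simp
  have E: "subgroup ?E ?K" "?K\<lparr>carrier := ?E\<rparr> \<cong> cyclic_square 2"
    using involutions_subgroup[OF h] iso_cyclic_square_2[OF h] by (simp_all add: d)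
  have uniq: "E = ?E" if "subgroup E ?K" "?K\<lparr>carrier := E\<rparr> \<cong> cyclic_square 2" for E
    using subgroup_iso_cyclic_square_2_unique[OF h] that by (simp add: d)
  have "\<exists>M. signature_set ?K x\<^sub>1 x\<^sub>2 M"
    if "x\<^sub>1 \<in> ?E" "x\<^sub>2 \<in> ?E" "?E = generate ?K {x\<^sub>1, x\<^sub>2}" for x\<^sub>1 x\<^sub>2
  proof -
    have gen: "?E = generate (cyclic_square (2 * 2 ^ k)) {x\<^sub>1, x\<^sub>2}"
      using that(3) by (simp only: d power_Suc)
    have "\<forall>u. \<exists>A. signature_block ?K (generate ?K {x\<^sub>1, x\<^sub>2}) (gr_char ?K x\<^sub>1 x\<^sub>2 u) A"
      using signature_block_exists[OF gen that(1,2)] by (simp only: d power_Suc gen) simp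
    \<comment> \<open>Choosing one block for each \<open>u\<close> gives the indexing function of
      the multiset.\<close>
    then show ?thesis unfolding signature_set_def by metis
  qed
  then show ?thesis using E uniq by metis
qed

end
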